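(* For a polynomial map $F : \mathbb{C}^n \to \mathbb{C}^n$ the following statements are equivalent. (1) $\sum_{i=1}^n (\mathcal{J}F)|_{X=\alpha_i}$ is invertible for all $\alpha_1,\ldots,\alpha_n \in \mathbb{C}^n$; (2) $F = L \circ (X+H)$, where $H$ is a polynomial map with no linear terms, the linear part $L$ of $F$ is invertible, and $\mathcal{J}H$ is additive-nilpotent; (3) $F = (X+H) \circ L$, where $H$ is a polynomial map with no linear terms, the linear part $L$ of $F$ is invertible, and $\mathcal{J}H$ is additive-nilpotent; (4) $F = L_1 \circ (X+H) \circ L_2$, where $L_1$ and $L_2$ are invertible maps of degree one and $H$ is a polynomial map such that $\mathcal{J}H$ is additive-nilpotent.
   Context: $X=(X_1,\ldots,X_n)$ denotes the coordinates, and also the identity map of $\mathbb{C}^n$. $\mathcal{J}F$ denotes the Jacobian matrix of $F$ with respect to $X$, and $(\mathcal{J}F)|_{X=\alpha}$ is its evaluation at $\alpha \in \mathbb{C}^n$. The linear part of a polynomial map is its homogeneous component of degree 1 (a linear map $\mathbb{C}^n\to\mathbb{C}^n$); having no linear terms means this component is zero (constant terms are allowed). Maps of degree one are affine maps $x\mapsto Ax+c$ with $A\ne0$. The Jacobian matrix $\mathcal{J}H$ of a polynomial map $H:\mathbb{C}^n\to\mathbb{C}^n$ is called additive-nilpotent if $\sum_{i=1}^m (\mathcal{J}H)|_{X=\alpha_i}$ is nilpotent for each positive integer $m$ and all $\alpha_1,\ldots,\alpha_m \in \mathbb{C}^n$. *)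

theory Defs
  imports "HOL-Analysis.Analysis" "HOL-Library.Poly_Mapping"
begin

text \<open>
  Polynomials over the complex numbers in variables indexed by a finite type \<open>'n\<close>: an exponent
  vector \<open>m :: 'n \<Rightarrow>\<^sub>0 nat\<close> is mapped to the coefficient of the monomial with exponents \<open>m\<close>.
  The dimension of the affine space is \<open>CARD('n)\<close>.
\<close>
type_synonym 'n cpoly = "('n \<Rightarrow>\<^sub>0 nat) \<Rightarrow>\<^sub>0 complex"

definition eval_poly :: "('n::finite) cpoly \<Rightarrow> complex^'n \<Rightarrow> complex" where
  "eval_poly p x =
     (\<Sum>m\<in>Poly_Mapping.keys p. Poly_Mapping.lookup p m * (\<Prod>i\<in>UNIV. (x $ i) ^ Poly_Mapping.lookup m i))"

text \<open>
  If \<open>i\<close> does not occur in the monomial \<open>m\<close>, the truncated subtraction is harmless, since the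
  coefficient is then \<open>0\<close>.
\<close>
definition partial_deriv :: "'n \<Rightarrow> ('n::finite) cpoly \<Rightarrow> 'n cpoly" where
  "partial_deriv i p =
     (\<Sum>m\<in>Poly_Mapping.keys p. Poly_Mapping.single (m - Poly_Mapping.single i 1)
                         (of_nat (Poly_Mapping.lookup m i) * Poly_Mapping.lookup p m))"

definition hom_component :: "nat \<Rightarrow> ('n::finite) cpoly \<Rightarrow> 'n cpoly" where
  "hom_component d p =
     (\<Sum>m\<in>{m \<in> Poly_Mapping.keys p. (\<Sum>i\<in>UNIV. Poly_Mapping.lookup m i) = d}.
        Poly_Mapping.single m (Poly_Mapping.lookup p m))"

type_synonym 'n polymap = "('n cpoly)^'n"

definition map_of_polymap :: "('n::finite) polymap \<Rightarrow> complex^'n \<Rightarrow> complex^'n" where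
  "map_of_polymap F x = (\<chi> i. eval_poly (F $ i) x)"

definition coordinates :: "('n::finite) polymap" where
  "coordinates = (\<chi> i. Poly_Mapping.single (Poly_Mapping.single i 1) 1)"

definition linear_part :: "('n::finite) polymap \<Rightarrow> 'n polymap" where
  "linear_part F = (\<chi> i. hom_component 1 (F $ i))"

definition jacobian_matrix :: "('n::finite) polymap \<Rightarrow> ('n cpoly)^'n^'n" where
  "jacobian_matrix F = (\<chi> i j. partial_deriv j (F $ i))"

definition eval_matrix :: "(('n::finite) cpoly)^'n^'n \<Rightarrow> complex^'n \<Rightarrow> complex^'n^'n" where
  "eval_matrix M \<alpha> = (\<chi> i j. eval_poly (M $ i $ j) \<alpha>)"

text \<open>
  The power operator \<open>^\<close> and the product \<open>*\<close> on \<open>complex^'n^'n\<close> are componentwise, so the powers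
  are taken with respect to matrix multiplication explicitly.
\<close>
definition nilpotent_matrix :: "complex^'n^'n \<Rightarrow> bool" where
  "nilpotent_matrix A \<longleftrightarrow> (\<exists>k. (((**) A) ^^ k) (mat 1) = 0)"

definition additive_nilpotent :: "(('n::finite) cpoly)^'n^'n \<Rightarrow> bool" where
  "additive_nilpotent M \<longleftrightarrow>
     (\<forall>m\<ge>1. \<forall>\<alpha> :: nat \<Rightarrow> complex^'n. nilpotent_matrix (\<Sum>i=1..m. eval_matrix M (\<alpha> i)))"

definition degree_one_map :: "(complex^'n \<Rightarrow> complex^'n) \<Rightarrow> bool" where
  "degree_one_map L \<longleftrightarrow> (\<exists>(A :: complex^'n^'n) c. A \<noteq> 0 \<and> L = (\<lambda>x. A *v x + c))"

end

theory Submission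
  imports Defs "HOL-Computational_Algebra.Fundamental_Theorem_Algebra"
begin

text \<open>
  The heart of the matter is that invertibility of all sums of \<open>n\<close> Jacobians forces nilpotency of
  sums of arbitrary length; the remaining implications are formal.

  Suppose (1) holds, and let \<open>J\<close> be the Jacobian of \<open>F\<close> at \<open>0\<close>. The case where all \<open>\<alpha>\<^sub>i\<close> vanish
  shows that \<open>n J\<close>, hence \<open>J\<close>, is invertible, and \<open>J\<close> is the matrix of the linear part \<open>L\<close> of \<open>F\<close>
  (\<open>map_of_linear_part\<close>). Replacing \<open>F\<close> by \<open>L\<^sup>-\<^sup>1 \<circ> F\<close>, or by \<open>F \<circ> L\<^sup>-\<^sup>1\<close>, only multiplies the sums of
  Jacobians by invertible matrices, so \<open>F = X + H\<close> may be assumed where the Jacobian of \<open>H\<close> vanishes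
  at \<open>0\<close>; these two normalisations yield (2) and (3) (\<open>normalised_polymap\<close>).

  The determinant of the sum of the Jacobians of \<open>F\<close> at \<open>t \<alpha>\<^sub>1, \<dots>, t \<alpha>\<^sub>n\<close> is a polynomial in \<open>t\<close>
  without complex roots, hence constant. Comparing \<open>t = 1\<close> with \<open>t = 0\<close> shows that
  \<open>det (n I + B\<^sub>1 + \<dots> + B\<^sub>n)\<close> has the same value for all Jacobians \<open>B\<^sub>1, \<dots>, B\<^sub>n\<close> of \<open>H\<close>
  (\<open>det_sum_jac_const\<close>). As \<open>0\<close> is one of these Jacobians, the same holds for fewer than \<open>n\<close>
  summands. Now \<open>X \<mapsto> det (n I + X)\<close> is a polynomial function of degree at most \<open>n\<close>, and such a
  function is determined on all sums of elements of a set by its values on the sums of at most \<open>n\<close>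
  elements; this follows by induction on the degree, by passing to differences
  (\<open>vanishes_on_sums_if_vanishes_on_short_sums\<close>). So the restriction on the number of summands
  disappears. In particular, if \<open>M\<close> is a sum of Jacobians of \<open>H\<close>, then so is \<open>k M\<close> for every natural
  number \<open>k\<close>, hence \<open>det (n I + t M)\<close> is constant for natural and therefore for complex \<open>t\<close>. Thus \<open>M\<close>
  has no nonzero eigenvalue, so it is nilpotent (\<open>sum_nilpotent_if_short_det_const\<close>).

  Each of (2) and (3) is a special case of (4). Finally, under (4) the chain rule turns a sum of \<open>n\<close>
  Jacobians of \<open>F\<close> into \<open>A (n I + M) B\<close> with \<open>A\<close> and \<open>B\<close> invertible and \<open>M\<close> nilpotent, which
  is invertible.
\<close>

section \<open>Nilpotent matrices\<close>

lemma matrix_matrix_add_rdistrib: "(A + B) ** C = A ** C + B ** (C :: 'a::semiring_1^'n^'m)"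
  by (simp add: vec_eq_iff matrix_matrix_mult_def sum.distrib distrib_right)

lemma matrix_mult_zero [simp]:
  "A ** 0 = (0 :: 'a::semiring_1^'n^'m)" "0 ** B = (0 :: 'a::semiring_1^'n^'m)"
  by (simp_all add: vec_eq_iff matrix_matrix_mult_def)

lemma mat_mult_component [simp]: "(mat c ** A) $ i $ j = c * (A :: 'a::semiring_1^'n^'m) $ i $ j"
  by (simp add: matrix_matrix_mult_def mat_def if_distrib[of "\<lambda>x. x * _"] cong: if_cong)

lemma mat_mult_commute: "mat c ** A = A ** mat (c :: 'a::comm_semiring_1)"
  by (simp add: vec_eq_iff matrix_matrix_mult_def mat_def if_distrib[of "\<lambda>x. x * _"]
      if_distrib[of "\<lambda>x. _ * x"] mult.commute cong: if_cong)

definition poly_mat :: "'a::comm_ring_1 poly \<Rightarrow> 'a^'n^'n \<Rightarrow> 'a^'n^'n" where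
  "poly_mat p M = fold_coeffs (\<lambda>a B. mat a + M ** B) p 0"

lemma poly_mat_0 [simp]: "poly_mat 0 M = 0"
  by (simp add: poly_mat_def)

lemma poly_mat_pCons [simp]: "poly_mat (pCons a p) M = mat a + M ** poly_mat p M"
  by (cases "p = 0 \<and> a = 0") (auto simp: poly_mat_def)

lemma poly_mat_add: "poly_mat (p + q) M = poly_mat p M + poly_mat q M"
proof (induction p q rule: poly_induct2)
  case (pCons a p b q)
  have "mat (a + b) = mat a + (mat b :: 'a^'n^'n)"
    by (simp add: vec_eq_iff mat_def)
  with pCons show ?case
    by (simp add: matrix_add_ldistrib)
qed simp

lemma poly_mat_smult: "poly_mat (smult c p) M = mat c ** poly_mat p M"
proof (induction p)
  case (pCons a p)
  have "M ** (mat c ** poly_mat p M) = mat c ** (M ** poly_mat p M)"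
    by (metis mat_mult_commute matrix_mul_assoc)
  moreover have "mat (c * a) = mat c ** (mat a :: 'a^'n^'n)"
    by (simp add: vec_eq_iff) (simp add: mat_def)
  ultimately show ?case
    using pCons by (simp add: matrix_add_ldistrib)
qed auto

lemma poly_mat_sum: "poly_mat (\<Sum>i\<in>I. p i) M = (\<Sum>i\<in>I. poly_mat (p i) M)"
  by (induction I rule: infinite_finite_induct) (auto simp: poly_mat_add)

lemma poly_mat_monom: "poly_mat (monom c i) M = mat c ** (((**) M) ^^ i) (mat 1)"
proof (induction i)
  case (Suc i)
  then show ?case
    by (simp add: monom_Suc) (metis mat_mult_commute matrix_mul_assoc)
qed (simp add: monom_0)

lemma poly_mat_commute: "poly_mat p M ** M = M ** poly_mat p M"
  by (induction p) (simp_all add: matrix_add_ldistrib matrix_matrix_add_rdistrib mat_mult_commute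
      flip: matrix_mul_assoc)

text \<open>
  The powers of \<open>M\<close> live in a finite-dimensional space, so they satisfy a linear relation. A relation
  with real coefficients is as good as a complex one, and real dimension theory applies to the type of
  complex matrices directly.
\<close>
lemma exists_annihilating_poly:
  fixes M :: "complex^'n^'n"
  shows "\<exists>p. p \<noteq> 0 \<and> poly_mat p M = 0"
proof -
  define P where "P i = (((**) M) ^^ i) (mat 1)" for i
  define N where "N = DIM(complex^'n^'n)"
  show ?thesis
  proof (cases "inj_on P {..N}")
    case False
    then obtain i j where ij: "i \<noteq> j" "P i = P j"
      by (auto simp: inj_on_def)
    \<comment> \<open>A repetition among the powers is a relation in itself, but is invisible in the set of powers.\<close>
    let ?p = "monom (1::complex) i + monom (-1) j"
    have "coeff ?p i = 1"
      using ij by simp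
    then have "?p \<noteq> 0"
      by (metis coeff_0 zero_neq_one)
    moreover have "poly_mat ?p M = 0"
      using ij by (simp add: poly_mat_add poly_mat_monom vec_eq_iff flip: P_def)
    ultimately show ?thesis by blast
  next
    case True
    then have "card (P ` {..N}) > DIM(complex^'n^'n)"
      by (simp add: card_image N_def)
    then have "dependent (P ` {..N})"
      by (intro dependent_biggerset) auto
    then obtain u v where v: "v \<in> P ` {..N}" "u v \<noteq> 0"
      and u: "(\<Sum>w\<in>P ` {..N}. u w *\<^sub>R w) = 0"
      by (auto simp: dependent_finite)
    then obtain i where i: "i \<le> N" "u (P i) \<noteq> 0" by auto
    define p where "p = (\<Sum>j\<le>N. monom (complex_of_real (u (P j))) j)"
    have "coeff p i \<noteq> 0"
      using i by (simp add: p_def coeff_sum)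
    moreover have "poly_mat p M = (\<Sum>j\<le>N. u (P j) *\<^sub>R P j)"
      unfolding p_def poly_mat_sum poly_mat_monom P_def[symmetric]
      by (intro sum.cong) (auto simp: vec_eq_iff scaleR_conv_of_real[where 'a = complex])
    then have "poly_mat p M = 0"
      using u True by (simp add: sum.reindex)
    ultimately show ?thesis by (metis coeff_0)
  qed
qed

text \<open>
  Split an annihilating polynomial into linear factors: those that belong to nonzero roots are
  injective and can be cancelled, so that only a power of \<open>M\<close> remains. The matrix \<open>N\<close> on the right
  absorbs the factors \<open>M\<close> during the induction.
\<close>
lemma annihilated_imp_power_annihilates:
  fixes M N :: "complex^'n^'n"
  assumes inj: "\<And>z N :: complex^'n^'n. z \<noteq> 0 \<Longrightarrow> M ** N = mat z ** N \<Longrightarrow> N = 0"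
    and "p \<noteq> 0" "poly_mat p M ** N = 0"
  shows "\<exists>k. (((**) M) ^^ k) N = 0"
  using assms(2,3)
proof (induction "degree p" arbitrary: p N rule: less_induct)
  case less
  show ?case
  proof (cases "degree p = 0")
    case True
    then obtain c where "p = [:c:]" by (metis degree_eq_zeroE)
    then have "c \<noteq> 0" "mat c ** N = 0"
      using less.prems by auto
    then have "N = 0"
      by (simp add: vec_eq_iff)
    then show ?thesis by (intro exI[of _ 0]) auto
  next
    case False
    then have "\<not> constant (poly p)"
      by (simp add: constant_degree)
    then obtain z where "poly p z = 0"
      by (meson fundamental_theorem_of_algebra)
    then obtain r where r: "p = [:-z, 1:] * r"
      using dvdE poly_eq_0_iff_dvd by blast
    have "r \<noteq> 0"
      using less.prems(1) r by auto
    moreover have "degree p = degree [:-z, 1:] + degree r"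
      unfolding r by (rule degree_mult_eq) (use \<open>r \<noteq> 0\<close> in auto)
    ultimately have deg: "r \<noteq> 0" "degree r < degree p"
      by auto
    have "p = smult (-z) r + pCons 0 r"
      using r by simp
    then have p: "poly_mat p M = mat (-z) ** poly_mat r M + M ** poly_mat r M"
      by (simp add: poly_mat_add poly_mat_smult del: smult_minus_left)
    show ?thesis
    proof (cases "z = 0")
      case True
      then have "poly_mat r M ** (M ** N) = 0"
        using less.prems(2) p by (simp add: matrix_mul_assoc poly_mat_commute)
      then obtain k where "(((**) M) ^^ k) (M ** N) = 0"
        using less.hyps[OF deg(2) deg(1)] by blast
      then have "(((**) M) ^^ (Suc k)) N = 0"
        by (simp add: funpow_swap1)
      then show ?thesis by blast
    next
      case False
      have "M ** (poly_mat r M ** N) = mat z ** (poly_mat r M ** N)"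
      proof -
        have "mat (-z) ** (poly_mat r M ** N) + M ** (poly_mat r M ** N) = 0"
          using less.prems(2) by (simp add: p matrix_matrix_add_rdistrib flip: matrix_mul_assoc)
        then show ?thesis
          by (simp add: vec_eq_iff add_eq_0_iff)
      qed
      then have "poly_mat r M ** N = 0"
        using inj False by blast
      then show ?thesis using less.hyps[OF deg(2) deg(1)] by blast
    qed
  qed
qed

lemma nilpotent_if_no_nonzero_eigenvalue:
  fixes M :: "complex^'n^'n"
  assumes "\<And>z N :: complex^'n^'n. z \<noteq> 0 \<Longrightarrow> M ** N = mat z ** N \<Longrightarrow> N = 0"
  shows "nilpotent_matrix M"
proof -
  obtain p where p: "p \<noteq> 0" "poly_mat p M = 0"
    using exists_annihilating_poly by blast
  have "\<exists>k. (((**) M) ^^ k) (mat 1) = 0"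
    by (rule annihilated_imp_power_annihilates[OF assms p(1)]) (simp_all add: p(2))
  then show ?thesis
    by (simp add: nilpotent_matrix_def)
qed

text \<open>
  A vector in the kernel of \<open>c I + M\<close> is an eigenvector of \<open>M\<close> for \<open>-c\<close>, or zero; a power of \<open>M\<close>
  multiplies it by a power of \<open>-c\<close> and kills it at the same time.
\<close>
lemma invertible_add_nilpotent:
  fixes M :: "complex^'n^'n"
  assumes "nilpotent_matrix M" "c \<noteq> 0"
  shows "invertible (mat c + M)"
proof -
  obtain k where k: "(((**) M) ^^ k) (mat 1) = 0"
    using assms(1) by (auto simp: nilpotent_matrix_def)
  have "x = 0" if x: "(mat c + M) *v x = 0" for x
  proof -
    have mat_v: "mat a *v y = a *s y" for a and y :: "complex^'n"
      by (simp add: vec_eq_iff matrix_vector_mult_def mat_def if_distrib[of "\<lambda>x. x * _"] cong: if_cong)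
    have "M *v x = (-c) *s x"
      using x by (simp add: matrix_vector_mult_add_rdistrib mat_v vec_eq_iff add_eq_0_iff)
    then have "((((**) M) ^^ j) (mat 1)) *v x = (-c) ^ j *s x" for j
      by (induction j)
         (simp_all add: vector_smult_assoc vec.scale mult.commute flip: matrix_vector_mul_assoc)
    from this[of k] k have "(-c) ^ k *s x = 0" by simp
    with \<open>c \<noteq> 0\<close> show "x = 0" by simp
  qed
  then show ?thesis
    by (simp add: invertible_left_inverse matrix_left_invertible_ker)
qed

section \<open>Functions of bounded degree with respect to differences\<close>

text \<open>
  A polynomial function of degree at most \<open>d\<close> vanishes after \<open>d + 1\<close> differences. Taking this as the
  notion of degree avoids polynomials in the entries of a matrix.
\<close>
fun difference_degree_le :: "nat \<Rightarrow> ('a::ab_group_add \<Rightarrow> 'b::comm_ring_1) \<Rightarrow> bool" where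
  "difference_degree_le 0 f \<longleftrightarrow> (\<forall>h x. f (x + h) - f x = 0)"
| "difference_degree_le (Suc d) f \<longleftrightarrow> (\<forall>h. difference_degree_le d (\<lambda>x. f (x + h) - f x))"

lemma difference_degree_le_const: "difference_degree_le d (\<lambda>x. c)"
  by (induction d arbitrary: c) auto

lemma difference_degree_le_add:
  "difference_degree_le d f \<Longrightarrow> difference_degree_le d g \<Longrightarrow> difference_degree_le d (\<lambda>x. f x + g x)"
proof (induction d arbitrary: f g)
  case (Suc d)
  have "difference_degree_le d (\<lambda>x. (f (x + h) - f x) + (g (x + h) - g x))" for h
    using Suc by simp
  then show ?case by (simp add: algebra_simps)
qed (simp add: algebra_simps)

lemma difference_degree_le_cmult:
  "difference_degree_le d f \<Longrightarrow> difference_degree_le d (\<lambda>x. c * f x)"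
proof (induction d arbitrary: f)
  case 0
  then show ?case by simp
next
  case (Suc d)
  have "difference_degree_le d (\<lambda>x. c * (f (x + h) - f x))" for h
    using Suc by simp
  then show ?case by (simp add: algebra_simps)
qed

lemma difference_degree_le_sum:
  "(\<And>i. i \<in> I \<Longrightarrow> difference_degree_le d (f i)) \<Longrightarrow> difference_degree_le d (\<lambda>x. \<Sum>i\<in>I. f i x)"
  by (induction I rule: infinite_finite_induct)
     (auto intro: difference_degree_le_const difference_degree_le_add)

lemma difference_degree_le_shift:
  "difference_degree_le d f \<Longrightarrow> difference_degree_le d (\<lambda>x. f (x + a))"
proof (induction d arbitrary: f)
  case 0
  then show ?case by simp
next
  case (Suc d)
  have "difference_degree_le d (\<lambda>x. f (x + a + h) - f (x + a))" for h
    using Suc.IH[of "\<lambda>x. f (x + h) - f x"] Suc.prems by simp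
  then show ?case by (simp add: ac_simps)
qed

text \<open>
  The product rule \<open>\<Delta>(l f)(x) = l(x) \<Delta>f(x) + m(h) f(x + h)\<close>, where \<open>m\<close> is the linear part of \<open>l\<close>.
\<close>
lemma difference_degree_le_affine_mult:
  assumes "difference_degree_le d f" and l: "\<And>x h. l (x + h) = l x + m h"
  shows "difference_degree_le (Suc d) (\<lambda>x. l x * f x)"
  using assms(1)
proof (induction d arbitrary: f)
  case 0
  have "difference_degree_le 0 (\<lambda>x. l (x + h) * f (x + h) - l x * f x)" for h
  proof -
    have f: "f (x + y) = f x" for x y
      using 0 by simp
    have m: "f x * m h = f y * m h" for x y
      using f[of x "y - x"] by simp
    show ?thesis by (simp add: f l distrib_right m)
  qed
  then show ?case by simp
next
  case (Suc d)
  have "difference_degree_le (Suc d) (\<lambda>x. l (x + h) * f (x + h) - l x * f x)" for h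
  proof -
    have "difference_degree_le (Suc d) (\<lambda>x. l x * (f (x + h) - f x))"
      using Suc.prems by (intro Suc.IH) simp
    moreover have "difference_degree_le (Suc d) (\<lambda>x. m h * f (x + h))"
      by (intro difference_degree_le_cmult difference_degree_le_shift Suc.prems)
    ultimately have "difference_degree_le (Suc d) (\<lambda>x. l x * (f (x + h) - f x) + m h * f (x + h))"
      by (rule difference_degree_le_add)
    then show ?thesis by (simp only: l algebra_simps)
  qed
  then show ?case by (simp only: difference_degree_le.simps(2)[of "Suc d"]) simp
qed

lemma difference_degree_le_prod_affine:
  assumes "finite I" "\<And>i x h. i \<in> I \<Longrightarrow> l i (x + h) = l i x + m i h"
  shows "difference_degree_le (card I) (\<lambda>x. \<Prod>i\<in>I. l i x)"
  using assms
proof (induction I rule: finite_induct)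
  case (insert i I)
  then have "difference_degree_le (Suc (card I)) (\<lambda>x. l i x * (\<Prod>i\<in>I. l i x))"
    by (intro difference_degree_le_affine_mult[where m = "m i"]) auto
  with insert show ?case
    by (simp del: difference_degree_le.simps)
qed simp

lemma difference_degree_le_det:
  "difference_degree_le CARD('n) (\<lambda>X :: 'a::comm_ring_1^'n^'n. det (A + X))"
proof -
  have "difference_degree_le CARD('n) (\<lambda>X. \<Prod>i\<in>UNIV. (A + X :: 'a^'n^'n) $ i $ s i)" for s
    by (rule difference_degree_le_prod_affine[where m = "\<lambda>i h. h $ i $ s i"]) auto
  then show ?thesis
    unfolding det_def by (intro difference_degree_le_sum difference_degree_le_cmult)
qed

text \<open>
  For \<open>b \<in> B\<close> the difference \<open>x \<mapsto> f(x + b) - f(x)\<close> has smaller degree and vanishes on sums of at most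
  \<open>d - 1\<close> elements, hence by induction on all sums. So adding elements of \<open>B\<close> one by one never changes
  the value of \<open>f\<close>, which is zero at the empty sum.
\<close>
lemma vanishes_on_sums_if_vanishes_on_short_sums:
  fixes f :: "'a::ab_group_add \<Rightarrow> 'b::comm_ring_1"
  assumes "difference_degree_le d f"
    and "\<And>xs. set xs \<subseteq> B \<Longrightarrow> length xs \<le> d \<Longrightarrow> f (sum_list xs) = 0"
    and "set xs \<subseteq> B"
  shows "f (sum_list xs) = 0"
  using assms
proof (induction d arbitrary: f xs)
  case 0
  then show ?case
    by (metis add_0 difference_degree_le.simps(1) eq_iff_diff_eq_0 le_zero_eq list.size(3)
        set_empty2 empty_subsetI sum_list.Nil)
next
  case (Suc d)
  note Suc' = Suc
  show ?case
    using Suc.prems(3)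
  proof (induction xs)
    case Nil
    show ?case using Suc'(3)[of "[]"] by simp
  next
    case (Cons b xs)
    have "f (sum_list ys + b) - f (sum_list ys) = 0" if "set ys \<subseteq> B" for ys
    proof (rule Suc'(1)[of "\<lambda>x. f (x + b) - f x"])
      fix zs assume "set zs \<subseteq> B" "length zs \<le> d"
      then show "f (sum_list zs + b) - f (sum_list zs) = 0"
        using Suc'(3)[of "b # zs"] Suc'(3)[of zs] Cons.prems by (simp add: add.commute)
    qed (use Suc'(2) that in auto)
    from this[of xs] Cons show ?case by (simp add: add.commute)
  qed
qed

section \<open>Nilpotency from constant determinants\<close>

lemma det_at_argument_is_poly:
  fixes P :: "'a::comm_ring_1 poly^'n^'n"
  shows "\<exists>q. \<forall>t. poly q t = det (\<chi> i j. poly (P $ i $ j) t)"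
  by (intro exI[of _ "det P"]) (simp add: det_def poly_sum poly_prod)

text \<open>
  The polynomial \<open>det (c I + t M)\<close> in \<open>t\<close> takes the value \<open>d\<close> at infinitely many points, so it is
  constant. If \<open>z \<noteq> 0\<close> were an eigenvalue of \<open>M\<close>, it would vanish at \<open>t = -c/z\<close>.
\<close>
lemma nilpotent_if_det_const:
  fixes M :: "complex^'n^'n"
  assumes c: "c \<noteq> 0" and d: "d \<noteq> 0" and det: "\<And>k. det (mat c + mat (of_nat k) ** M) = d"
  shows "nilpotent_matrix M"
proof -
  obtain q where q: "\<And>t. poly q t = det (\<chi> i j. poly ((\<chi> i j. [:mat c $ i $ j, M $ i $ j:]) $ i $ j) t)"
    using det_at_argument_is_poly by blast
  have q': "poly q t = det (mat c + mat t ** M)" for t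
    unfolding q by (rule arg_cong[of _ _ det]) (simp add: vec_eq_iff)
  have "q - [:d:] = 0"
  proof (rule ccontr)
    assume "q - [:d:] \<noteq> 0"
    then have "finite {t. poly (q - [:d:]) t = 0}"
      by (rule poly_roots_finite)
    moreover have "range of_nat \<subseteq> {t. poly (q - [:d:]) t = 0}"
      using det by (auto simp: q')
    ultimately have "finite (range (of_nat :: nat \<Rightarrow> complex))"
      by (rule finite_subset[rotated])
    then show False
      using finite_imageD inj_of_nat infinite_UNIV_nat by blast
  qed
  then have det': "det (mat c + mat t ** M) = d" for t
    using q'[of t] by simp
  show ?thesis
  proof (rule nilpotent_if_no_nonzero_eigenvalue)
    fix z and N :: "complex^'n^'n"
    assume z: "z \<noteq> 0" "M ** N = mat z ** N"
    let ?A = "mat c + mat (-c/z) ** M"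
    have "invertible ?A"
      using d det' by (simp add: invertible_det_nz)
    then obtain C where C: "C ** ?A = mat 1"
      by (auto simp: invertible_left_inverse)
    have "?A ** N = mat c ** N + mat (-c/z) ** (mat z ** N)"
      by (simp add: matrix_matrix_add_rdistrib z(2) flip: matrix_mul_assoc)
    also have "\<dots> = 0"
      using z(1) by (simp add: vec_eq_iff)
    finally have "(C ** ?A) ** N = 0" by (simp flip: matrix_mul_assoc)
    then show "N = 0" by (simp only: C matrix_mul_lid)
  qed
qed

text \<open>
  The determinant condition extends from short sums to all sums. Repeating a list of summands \<open>k\<close> times
  then provides the multiples \<open>k M\<close> that the criterion above asks for.
\<close>
lemma sum_nilpotent_if_short_det_const:
  fixes B :: "(complex^'n^'n) set"
  assumes c: "c \<noteq> 0" and d: "d \<noteq> 0"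
    and det: "\<And>Ms. set Ms \<subseteq> B \<Longrightarrow> length Ms \<le> CARD('n) \<Longrightarrow> det (mat c + sum_list Ms) = d"
    and Ms: "set Ms \<subseteq> B"
  shows "nilpotent_matrix (sum_list Ms)"
proof (rule nilpotent_if_det_const[OF c d])
  have deg: "difference_degree_le CARD('n) (\<lambda>X :: complex^'n^'n. det (mat c + X) + (-d))"
    by (intro difference_degree_le_add difference_degree_le_det difference_degree_le_const)
  fix k
  let ?Ns = "concat (replicate k Ms)"
  have "det (mat c + sum_list ?Ns) + (-d) = 0"
    by (rule vanishes_on_sums_if_vanishes_on_short_sums[OF deg, of B])
       (use det Ms in auto)
  moreover have "sum_list ?Ns = mat (of_nat k) ** sum_list Ms"
    by (induction k) (simp_all add: vec_eq_iff algebra_simps)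
  ultimately show "det (mat c + mat (of_nat k) ** sum_list Ms) = d" by simp
qed

section \<open>Evaluation of polynomials\<close>

abbreviation "lookup \<equiv> Poly_Mapping.lookup"
abbreviation "single \<equiv> Poly_Mapping.single"
abbreviation "keys \<equiv> Poly_Mapping.keys"

lemma eval_poly_superset:
  assumes "finite S" "keys p \<subseteq> S"
  shows "eval_poly p x = (\<Sum>m\<in>S. lookup p m * (\<Prod>i\<in>UNIV. (x $ i) ^ lookup m i))"
  unfolding eval_poly_def
  by (rule sum.mono_neutral_left) (use assms in \<open>auto simp: in_keys_iff\<close>)

lemma eval_poly_single [simp]:
  "eval_poly (single m c) x = c * (\<Prod>i\<in>UNIV. (x $ i) ^ lookup m i)"
  by (subst eval_poly_superset[of "{m}"]) (auto simp: lookup_single)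

lemma eval_poly_0 [simp]: "eval_poly 0 x = 0"
  by (simp add: eval_poly_def)

lemma eval_poly_add [simp]: "eval_poly (p + q) x = eval_poly p x + eval_poly q x"
proof -
  have "keys (p + q) \<subseteq> keys p \<union> keys q"
    by (rule Poly_Mapping.keys_add)
  then show ?thesis
    by (simp add: eval_poly_superset[of "keys p \<union> keys q"] lookup_add distrib_right sum.distrib)
qed

lemma eval_poly_sum: "eval_poly (\<Sum>i\<in>I. p i) x = (\<Sum>i\<in>I. eval_poly (p i) x)"
  by (induction I rule: infinite_finite_induct) auto

lemma sum_of_monomials: "p = (\<Sum>m\<in>keys p. single m (lookup p m))"
proof (rule poly_mapping_eqI)
  fix k
  show "lookup p k = lookup (\<Sum>m\<in>keys p. single m (lookup p m)) k"
    by (simp add: lookup_sum lookup_single when_def in_keys_iff)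
qed

lemma eval_poly_single_mult:
  "eval_poly (single m c * single m' c') x = eval_poly (single m c) x * eval_poly (single m' c') x"
  by (simp add: mult_single lookup_add power_add prod.distrib)

lemma eval_poly_mult [simp]: "eval_poly (p * q) x = eval_poly p x * eval_poly q x"
proof -
  have "eval_poly (p * q) x =
    eval_poly ((\<Sum>m\<in>keys p. single m (lookup p m)) * (\<Sum>m\<in>keys q. single m (lookup q m))) x"
    by (simp flip: sum_of_monomials)
  also have "\<dots> = eval_poly (\<Sum>m\<in>keys p. single m (lookup p m)) x * eval_poly (\<Sum>m\<in>keys q. single m (lookup q m)) x"
    by (simp only: sum_product eval_poly_sum eval_poly_single_mult)
  finally show ?thesis by (simp flip: sum_of_monomials)
qed

section \<open>Linear changes of coordinates\<close>

definition polynomial_fun :: "(complex^'n \<Rightarrow> complex) \<Rightarrow> bool" where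
  "polynomial_fun f \<longleftrightarrow> (\<exists>p. f = eval_poly p)"

lemma polynomial_fun_const: "polynomial_fun (\<lambda>x. c)"
  unfolding polynomial_fun_def by (intro exI[of _ "single 0 c"]) auto

lemma prod_power_lookup_single [simp]:
  "(\<Prod>i\<in>UNIV. f i ^ lookup (single j 1) i) = (f (j :: 'n::finite) :: 'a::comm_semiring_1)"
  by (subst prod.remove[of _ j]) (auto simp: lookup_single)

lemma polynomial_fun_component: "polynomial_fun (\<lambda>x. x $ i)"
  unfolding polynomial_fun_def by (intro exI[of _ "single (single i 1) 1"]) (simp add: fun_eq_iff del: One_nat_def)

lemma polynomial_fun_add:
  "polynomial_fun f \<Longrightarrow> polynomial_fun g \<Longrightarrow> polynomial_fun (\<lambda>x. f x + g x)"
proof -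
  assume "polynomial_fun f" "polynomial_fun g"
  then obtain p q where "f = eval_poly p" "g = eval_poly q"
    by (auto simp: polynomial_fun_def)
  then have "(\<lambda>x. f x + g x) = eval_poly (p + q)"
    by (simp add: fun_eq_iff)
  then show ?thesis
    unfolding polynomial_fun_def by blast
qed

lemma polynomial_fun_mult:
  "polynomial_fun f \<Longrightarrow> polynomial_fun g \<Longrightarrow> polynomial_fun (\<lambda>x. f x * g x)"
proof -
  assume "polynomial_fun f" "polynomial_fun g"
  then obtain p q where "f = eval_poly p" "g = eval_poly q"
    by (auto simp: polynomial_fun_def)
  then have "(\<lambda>x. f x * g x) = eval_poly (p * q)"
    by (simp add: fun_eq_iff)
  then show ?thesis
    unfolding polynomial_fun_def by blast
qed

lemma polynomial_fun_sum:
  "(\<And>i. i \<in> I \<Longrightarrow> polynomial_fun (f i)) \<Longrightarrow> polynomial_fun (\<lambda>x. \<Sum>i\<in>I. f i x)"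
  by (induction I rule: infinite_finite_induct)
     (auto intro: polynomial_fun_const polynomial_fun_add)

lemma polynomial_fun_prod:
  "(\<And>i. i \<in> I \<Longrightarrow> polynomial_fun (f i)) \<Longrightarrow> polynomial_fun (\<lambda>x. \<Prod>i\<in>I. f i x)"
  by (induction I rule: infinite_finite_induct)
     (auto intro: polynomial_fun_const polynomial_fun_mult)

lemma polynomial_fun_power: "polynomial_fun f \<Longrightarrow> polynomial_fun (\<lambda>x. f x ^ k)"
  by (induction k) (auto intro: polynomial_fun_const polynomial_fun_mult)

lemma polynomial_fun_compose_linear:
  "polynomial_fun (\<lambda>x :: complex^'n. eval_poly p (A *v x))"
  unfolding eval_poly_def matrix_vector_mult_def
  by (auto intro!: polynomial_fun_sum polynomial_fun_mult polynomial_fun_const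
      polynomial_fun_prod polynomial_fun_power polynomial_fun_component)

text \<open>
  Functions given by polynomials are closed under sums and products, hence under linear substitutions;
  the coefficients of the resulting polynomials never have to be computed.
\<close>
lemma exists_polymap_linear_conjugate:
  fixes F :: "'n::finite polymap" and A B :: "complex^'n^'n"
  shows "\<exists>G :: 'n polymap. map_of_polymap G = (\<lambda>x. A *v map_of_polymap F (B *v x))"
proof -
  have "\<exists>p. (\<lambda>x. (A *v map_of_polymap F (B *v x)) $ i) = eval_poly p" for i
    unfolding polynomial_fun_def[symmetric] map_of_polymap_def
    by (auto simp: matrix_vector_mult_def[of A] intro!: polynomial_fun_sum polynomial_fun_mult polynomial_fun_const
      polynomial_fun_compose_linear)
  then obtain g where "\<And>i. (\<lambda>x. (A *v map_of_polymap F (B *v x)) $ i) = eval_poly (g i)"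
    by metis
  then have "map_of_polymap (\<chi> i. g i) = (\<lambda>x. A *v map_of_polymap F (B *v x))"
    by (simp add: map_of_polymap_def fun_eq_iff vec_eq_iff)
  then show ?thesis by blast
qed

section \<open>The Jacobian matrix as a derivative\<close>

lemma eval_poly_partial_deriv:
  "eval_poly (partial_deriv j p) x =
     (\<Sum>m\<in>keys p. eval_poly (single (m - single j 1) (of_nat (lookup m j) * lookup p m)) x)"
  unfolding partial_deriv_def eval_poly_sum ..

lemma has_derivative_eval_poly:
  fixes p :: "'n::finite cpoly"
  shows "(eval_poly p has_derivative (\<lambda>h. \<Sum>j\<in>UNIV. eval_poly (partial_deriv j p) x * h $ j)) (at x)"
proof -
  have mono: "((\<lambda>x. c * (\<Prod>i\<in>UNIV. (x $ i) ^ lookup m i)) has_derivative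
     (\<lambda>h. \<Sum>j\<in>UNIV. eval_poly (single (m - single j 1) (of_nat (lookup m j) * c)) x * h $ j)) (at x)"
    for m and c
  proof -
    have nth: "((\<lambda>x::complex^'n. x $ i) has_derivative (\<lambda>h. h $ i)) (at x)" for i
      by (rule bounded_linear_imp_has_derivative) (rule bounded_linear_vec_nth)
    have "((\<lambda>x. c * (\<Prod>i\<in>UNIV. (x $ i) ^ lookup m i)) has_derivative
      (\<lambda>h. c * (\<Sum>j\<in>UNIV. (of_nat (lookup m j) * h $ j * (x $ j) ^ (lookup m j - 1)) *
         (\<Prod>i\<in>UNIV - {j}. (x $ i) ^ lookup m i)))) (at x)"
      by (intro has_derivative_mult_right has_derivative_prod has_derivative_power nth)
    moreover have "c * (of_nat (lookup m j) * h $ j * (x $ j) ^ (lookup m j - 1) *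
         (\<Prod>i\<in>UNIV - {j}. (x $ i) ^ lookup m i)) =
         eval_poly (single (m - single j 1) (of_nat (lookup m j) * c)) x * h $ j" for j and h :: "complex^'n"
    proof -
      have "(\<Prod>i\<in>UNIV. (x $ i) ^ lookup (m - single j 1) i) =
        (x $ j) ^ (lookup m j - 1) * (\<Prod>i\<in>UNIV - {j}. (x $ i) ^ lookup m i)"
        by (subst prod.remove[of _ j]) (auto simp: lookup_minus lookup_single intro!: prod.cong)
      then show ?thesis by (simp add: mult_ac)
    qed
    ultimately show ?thesis
      by (simp only: sum_distrib_left)
  qed
  have "((\<lambda>x. \<Sum>m\<in>keys p. lookup p m * (\<Prod>i\<in>UNIV. (x $ i) ^ lookup m i)) has_derivative
     (\<lambda>h. \<Sum>m\<in>keys p. \<Sum>j\<in>UNIV. eval_poly (single (m - single j 1) (of_nat (lookup m j) * lookup p m)) x * h $ j)) (at x)"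
    by (intro has_derivative_sum mono)
  then show ?thesis
    unfolding eval_poly_partial_deriv sum_distrib_right
    by (subst sum.swap) (simp add: eval_poly_def[abs_def])
qed

abbreviation jac :: "'n::finite polymap \<Rightarrow> complex^'n \<Rightarrow> complex^'n^'n" where
  "jac F \<equiv> eval_matrix (jacobian_matrix F)"

lemma has_derivative_map_of_polymap:
  "(map_of_polymap F has_derivative (*v) (jac F x)) (at x)"
proof -
  have "((\<lambda>x. map_of_polymap F x $ i) has_derivative (\<lambda>h. (jac F x *v h) $ i)) (at x)" for i
    using has_derivative_eval_poly[of "F $ i" x]
    by (simp add: map_of_polymap_def matrix_vector_mult_def eval_matrix_def jacobian_matrix_def eta_contract_eq)
  then show ?thesis
    unfolding has_derivative_componentwise_within[of "map_of_polymap F"]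
    by (auto simp: Basis_vec_def inner_axis intro!: has_derivative_inner_left)
qed

text \<open>
  By uniqueness of derivatives, formal Jacobians can be computed from the functions alone. In this way
  the chain rule of analysis replaces a formal one.
\<close>
lemma jac_eqI:
  assumes "(map_of_polymap F has_derivative (*v) A) (at x)"
  shows "jac F x = A"
  using has_derivative_unique[OF assms has_derivative_map_of_polymap]
  by (metis matrix_eq)

lemma map_of_polymap_add: "map_of_polymap (F + G) x = map_of_polymap F x + map_of_polymap G x"
  by (simp add: map_of_polymap_def vec_eq_iff)

lemma map_of_polymap_coordinates: "map_of_polymap coordinates x = x"
  by (simp add: map_of_polymap_def vec_eq_iff coordinates_def del: One_nat_def)

lemma lookup_hom_component:
  "lookup (hom_component d p) m = (if (\<Sum>i\<in>UNIV. lookup m i) = d then lookup p m else 0)"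
  unfolding hom_component_def by (auto simp: lookup_sum lookup_single when_def in_keys_iff)

lemma degree_one_exponent:
  fixes m :: "'n::finite \<Rightarrow>\<^sub>0 nat"
  shows "(\<Sum>i\<in>UNIV. lookup m i) = 1 \<longleftrightarrow> (\<exists>j. m = single j 1)"
proof
  assume *: "(\<Sum>i\<in>UNIV. lookup m i) = 1"
  then obtain j where j: "lookup m j = 1" "\<And>i. i \<noteq> j \<Longrightarrow> lookup m i = 0"
    by (auto simp: sum_eq_Suc0_iff)
  have "m = single j 1"
    by (rule poly_mapping_eqI) (use j in \<open>auto simp: lookup_single when_def\<close>)
  then show "\<exists>j. m = single j 1" by blast
qed (auto simp: lookup_single when_def)

text \<open>
  At the origin only the constant term of the partial derivative survives. It comes from the monomial
  \<open>X\<^sub>j\<close> alone: the truncated subtraction leaves the constant monomial in place as well, but its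
  coefficient is multiplied by \<open>0\<close>.
\<close>
lemma eval_poly_partial_deriv_0:
  fixes p :: "'n::finite cpoly"
  shows "eval_poly (partial_deriv j p) 0 = lookup p (single j 1)"
proof -
  have "eval_poly (single (m - single j 1) (of_nat (lookup m j) * c)) 0 = (if m = single j 1 then c else 0)"
    for m :: "'n \<Rightarrow>\<^sub>0 nat" and c
  proof (cases "lookup m j = 0 \<or> m = single j 1")
    case False
    have "m - single j 1 \<noteq> 0"
    proof
      assume "m - single j 1 = 0"
      then have "lookup m i - lookup (single j 1) i = 0" for i
        by (metis lookup_minus lookup_zero)
      then have le: "lookup m i \<le> lookup (single j 1) i" for i by simp
      have "lookup m i = lookup (single j 1) i" for i
        using le[of i] False by (cases "i = j") (auto simp: lookup_single when_def)
      then have "m = single j 1"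
        by (rule poly_mapping_eqI)
      with False show False by simp
    qed
    then obtain i where "lookup (m - single j 1) i \<noteq> 0"
      by (metis poly_mapping_eqI lookup_zero)
    then have "(\<Prod>i\<in>UNIV. (0::complex) ^ lookup (m - single j 1) i) = 0"
      by (intro prod_zero) auto
    then show ?thesis using False by simp
  qed auto
  then show ?thesis
    unfolding eval_poly_partial_deriv by (simp add: in_keys_iff)
qed

lemma map_of_linear_part:
  fixes F :: "'n::finite polymap"
  shows "map_of_polymap (linear_part F) x = jac F 0 *v x"
proof -
  have "eval_poly (hom_component 1 p) x = (\<Sum>j\<in>UNIV. lookup p (single j 1) * x $ j)" for p :: "'n cpoly"
  proof -
    have inj: "inj (\<lambda>j::'n. single j (1::nat))"
      by (rule injI) (metis lookup_single_eq lookup_single_not_eq one_neq_zero)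
    have "eval_poly (hom_component 1 p) x = (\<Sum>m\<in>range (\<lambda>j. single j 1). lookup (hom_component 1 p) m * (\<Prod>i\<in>UNIV. (x $ i) ^ lookup m i))"
      by (rule eval_poly_superset)
         (auto simp: in_keys_iff lookup_hom_component degree_one_exponent simp del: One_nat_def split: if_splits)
    also have "\<dots> = (\<Sum>j\<in>UNIV. lookup (hom_component 1 p) (single j 1) * x $ j)"
      by (simp only: sum.reindex[OF inj] comp_def prod_power_lookup_single)
    also have "\<dots> = (\<Sum>j\<in>UNIV. lookup p (single j 1) * x $ j)"
    proof -
      have "lookup (hom_component 1 p) (single j 1) = lookup p (single j 1)" for j
        unfolding lookup_hom_component degree_one_exponent by metis
      then show ?thesis by (simp only:)
    qed
    finally show ?thesis .
  qed
  then show ?thesis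
    by (simp add: map_of_polymap_def linear_part_def vec_eq_iff matrix_vector_mult_def eval_matrix_def
        jacobian_matrix_def eval_poly_partial_deriv_0 del: One_nat_def)
qed

lemma linear_part_eq_0_if_jac_0:
  assumes "jac H 0 = 0"
  shows "linear_part H = 0"
proof -
  have "lookup (H $ i) (single j 1) = 0" for i j
    using arg_cong[OF assms, of "\<lambda>M. M $ i $ j"]
    by (simp add: eval_matrix_def jacobian_matrix_def eval_poly_partial_deriv_0 del: One_nat_def)
  then show ?thesis
    unfolding linear_part_def vec_eq_iff
    by (auto intro!: poly_mapping_eqI simp: lookup_hom_component degree_one_exponent simp del: One_nat_def)
qed


section \<open>Sums of Jacobian matrices\<close>

lemma has_derivative_matrix_vector_mult: "((*v) A has_derivative (*v) A) (at (x :: complex^'n))"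
  by (intro bounded_linear_imp_has_derivative linear_conv_bounded_linear[THEN iffD1]
      matrix_vector_mul_linear)

lemma jac_affine_conjugate:
  fixes F G :: "'n::finite polymap"
  assumes "map_of_polymap F = (\<lambda>x. A *v map_of_polymap G (B *v x + b) + a)"
  shows "jac F x = A ** jac G (B *v x + b) ** B"
proof (rule jac_eqI)
  have "((\<lambda>x. B *v x + b) has_derivative (*v) B) (at x)"
    using has_derivative_add[OF has_derivative_matrix_vector_mult[of B x] has_derivative_const[of b]]
    by simp
  from has_derivative_compose[OF this has_derivative_map_of_polymap[of G]]
  have "((\<lambda>x. map_of_polymap G (B *v x + b)) has_derivative
      (\<lambda>h. jac G (B *v x + b) *v (B *v h))) (at x)" .
  from has_derivative_compose[OF this has_derivative_matrix_vector_mult[of A]]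
  have "((\<lambda>x. A *v map_of_polymap G (B *v x + b)) has_derivative
      (\<lambda>h. A *v (jac G (B *v x + b) *v (B *v h)))) (at x)" .
  from has_derivative_add[OF this has_derivative_const[of a]]
  show "(map_of_polymap F has_derivative (*v) (A ** jac G (B *v x + b) ** B)) (at x)"
    by (simp add: assms matrix_vector_mul_assoc matrix_mul_assoc)
qed

lemma jac_coordinates_add: "jac (coordinates + H) x = mat 1 + jac H x"
proof (rule jac_eqI)
  have "map_of_polymap (coordinates + H) = (\<lambda>x. x + map_of_polymap H x)"
    by (simp add: fun_eq_iff map_of_polymap_add map_of_polymap_coordinates)
  then show "(map_of_polymap (coordinates + H) has_derivative (*v) (mat 1 + jac H x)) (at x)"
    using has_derivative_add[OF has_derivative_ident has_derivative_map_of_polymap[of H x]]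
    by (simp add: matrix_vector_mult_add_rdistrib[abs_def])
qed

lemma sum_jac_coordinates_add:
  "(\<Sum>i=1..m. jac (coordinates + H) (\<alpha> i)) = mat (of_nat m) + (\<Sum>i=1..m. jac H (\<alpha> i))"
proof -
  have "(\<Sum>i=1..m. mat 1) = (mat (of_nat m) :: complex^'n^'n)"
    by (induction m) (simp_all add: vec_eq_iff mat_def del: sum_constant)
  then show ?thesis
    by (simp add: jac_coordinates_add sum.distrib)
qed

lemma eval_poly_on_ray:
  "\<exists>q. \<forall>t. poly q t = eval_poly p (t *s \<alpha>)"
proof
  show "\<forall>t. poly (\<Sum>m\<in>keys p. smult (lookup p m) (\<Prod>i\<in>UNIV. [:0, \<alpha> $ i:] ^ lookup m i)) t
     = eval_poly p (t *s \<alpha>)"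
    by (simp add: eval_poly_def poly_sum poly_prod)
qed

text \<open>
  Restricted to the ray through \<open>(\<alpha> i)\<^sub>i\<close> the determinant is a univariate polynomial, which has no
  roots and hence is constant by the fundamental theorem of algebra.
\<close>
lemma det_sum_jac_const:
  fixes F :: "'n::finite polymap"
  assumes "\<And>\<alpha>. invertible (\<Sum>i\<in>I. jac F (\<alpha> i))"
  shows "det (\<Sum>i\<in>I. jac F (\<alpha> i)) = det (\<Sum>i\<in>I. jac F 0)"
proof -
  have "\<forall>p :: 'n cpoly. \<forall>a. \<exists>q. \<forall>t. poly q t = eval_poly p (t *s a)"
    using eval_poly_on_ray by blast
  then obtain r where r: "poly (r p a) t = eval_poly p (t *s a)" for p :: "'n cpoly" and a t
    by metis
  obtain q where q: "poly q t = det (\<chi> i j. poly ((\<chi> i j. \<Sum>k\<in>I. r (jacobian_matrix F $ i $ j) (\<alpha> k)) $ i $ j) t)" for t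
    using det_at_argument_is_poly by blast
  have q': "poly q t = det (\<Sum>k\<in>I. jac F (t *s \<alpha> k))" for t
    unfolding q by (rule arg_cong[of _ _ det]) (simp add: vec_eq_iff poly_sum r eval_matrix_def)
  have "poly q t \<noteq> 0" for t
    unfolding q' using assms by (simp flip: invertible_det_nz)
  then have "constant (poly q)"
    using fundamental_theorem_of_algebra by blast
  then have "poly q 1 = poly q 0"
    by (simp add: constant_def)
  then show ?thesis by (simp add: q')
qed

text \<open>
  Lists of at most \<open>n\<close> Jacobians are padded to length \<open>n\<close> by the Jacobian at \<open>0\<close>, which is zero.
\<close>
lemma additive_nilpotent_if_invertible:
  fixes H :: "'n::finite polymap"
  assumes inv: "\<And>\<alpha> :: nat \<Rightarrow> complex^'n. invertible (\<Sum>i=1..CARD('n). jac (coordinates + H) (\<alpha> i))"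
    and H0: "jac H 0 = 0"
  shows "additive_nilpotent (jacobian_matrix H)"
proof -
  define d where "d = det (mat (of_nat CARD('n)) :: complex^'n^'n)"
  have const: "det (mat (of_nat CARD('n)) + (\<Sum>i=1..CARD('n). jac H (\<alpha> i))) = d" for \<alpha>
    using det_sum_jac_const[OF inv, of \<alpha>]
    by (simp only: sum_jac_coordinates_add d_def H0 sum.neutral_const add_0_right)
  have d: "d \<noteq> 0"
    using inv[of "\<lambda>_. 0"] by (simp only: sum_jac_coordinates_add H0 d_def invertible_det_nz) simp
  have short: "det (mat (of_nat CARD('n)) + sum_list Ms) = d"
    if Ms: "set Ms \<subseteq> range (jac H)" "length Ms \<le> CARD('n)" for Ms
  proof -
    obtain as where as: "Ms = map (jac H) as"
      using Ms(1) by (metis ex_map_conv image_iff subsetD)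
    \<comment> \<open>The points are indexed from \<open>1\<close>, the list from \<open>0\<close>.\<close>
    let ?\<alpha> = "\<lambda>i. if i - 1 < length as then as ! (i - 1) else 0"
    have "(\<Sum>i=1..CARD('n). jac H (?\<alpha> i)) = (\<Sum>i<CARD('n). if i < length as then jac H (as ! i) else 0)"
      by (simp add: sum.atLeast1_atMost_eq H0 if_distrib[of "jac H"] cong: if_cong)
    also have "\<dots> = (\<Sum>i<length as. jac H (as ! i))"
      using Ms(2) as by (intro sum.mono_neutral_cong_right) auto
    also have "\<dots> = sum_list Ms"
      by (simp add: as sum_list_sum_nth atLeast0LessThan)
    finally show ?thesis using const[of ?\<alpha>] by simp
  qed
  show ?thesis
    unfolding additive_nilpotent_def
  proof (intro allI impI)
    fix m and \<alpha> :: "nat \<Rightarrow> complex^'n"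
    have "nilpotent_matrix (sum_list (map (\<lambda>i. jac H (\<alpha> i)) [1..<Suc m]))"
      by (rule sum_nilpotent_if_short_det_const[OF _ d short]) auto
    then show "nilpotent_matrix (\<Sum>i=1..m. jac H (\<alpha> i))"
      by (simp only: interv_sum_list_conv_sum_set_nat set_upt atLeastLessThanSuc_atLeastAtMost)
  qed
qed

lemma invertible_if_additive_nilpotent:
  fixes H :: "'n::finite polymap"
  assumes "additive_nilpotent (jacobian_matrix H)"
  shows "invertible (\<Sum>i=1..CARD('n). jac (coordinates + H) (\<alpha> i))"
  unfolding sum_jac_coordinates_add
  by (rule invertible_add_nilpotent)
     (use assms in \<open>auto simp: additive_nilpotent_def Suc_le_eq\<close>)

lemma sum_matrix_conjugate: "(\<Sum>i\<in>I. A ** M i ** B) = A ** (\<Sum>i\<in>I. M i) ** (B :: complex^'n^'n)"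
  by (induction I rule: infinite_finite_induct) (auto simp: matrix_add_ldistrib matrix_matrix_add_rdistrib)

text \<open>
  The hypothesis on \<open>A\<close> and \<open>B\<close> makes the Jacobian of \<open>A F B\<close> at \<open>0\<close> the identity. Composing with the
  inverse of the linear part on the left corresponds to \<open>B = I\<close>, on the right to \<open>A = I\<close>.
\<close>
lemma normalised_polymap:
  fixes F :: "'n::finite polymap" and A B :: "complex^'n^'n"
  assumes inv: "\<And>\<alpha> :: nat \<Rightarrow> complex^'n. invertible (\<Sum>i=1..CARD('n). jac F (\<alpha> i))"
    and AB: "A ** jac F 0 ** B = mat 1"
  shows "\<exists>H. map_of_polymap (coordinates + H) = (\<lambda>x. A *v map_of_polymap F (B *v x)) \<and>
    linear_part H = 0 \<and> additive_nilpotent (jacobian_matrix H)"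
proof -
  obtain G :: "'n polymap" where G: "map_of_polymap G = (\<lambda>x. A *v map_of_polymap F (B *v x))"
    using exists_polymap_linear_conjugate by blast
  have jac_G: "jac G x = A ** jac F (B *v x) ** B" for x
    using jac_affine_conjugate[of G A F B 0 0 x] by (simp add: G)
  define H where "H = G - coordinates"
  have GH: "coordinates + H = G"
    by (simp add: H_def)
  have "invertible A"
    using AB unfolding invertible_right_inverse by (metis matrix_mul_assoc)
  moreover have "invertible B"
    using AB unfolding invertible_left_inverse by blast
  ultimately have "invertible (\<Sum>i=1..CARD('n). jac (coordinates + H) (\<alpha> i))" for \<alpha>
    unfolding GH jac_G sum_matrix_conjugate by (intro invertible_mult inv)
  moreover have H0: "jac H 0 = 0"
    using jac_coordinates_add[of H 0] AB by (simp add: GH jac_G)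
  ultimately have "additive_nilpotent (jacobian_matrix H)"
    by (intro additive_nilpotent_if_invertible)
  then show ?thesis
    using linear_part_eq_0_if_jac_0[OF H0] GH G by blast
qed

lemma bij_affine_iff_invertible:
  "bij (\<lambda>x. A *v x + c) \<longleftrightarrow> invertible (A :: complex^'n^'n)"
proof -
  have trans: "bij (\<lambda>y. y + c)" for c :: "complex^'n"
    by (rule bij_plus_right)
  have "(*v) A = (\<lambda>y. y + (-c)) \<circ> (\<lambda>x. A *v x + c)" "(\<lambda>x. A *v x + c) = (\<lambda>y. y + c) \<circ> (*v) A"
    by auto
  then have "bij (\<lambda>x. A *v x + c) \<longleftrightarrow> bij ((*v) A)"
    by (metis bij_comp trans)
  then show ?thesis by (simp add: invertible_eq_bij)
qed

lemma degree_one_map_if_invertible: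
  fixes A :: "complex^'n^'n"
  assumes "invertible A"
  shows "degree_one_map ((*v) A)"
proof -
  have "mat 1 \<noteq> (0 :: complex^'n^'n)"
    by (simp add: vec_eq_iff mat_def)
  then have "A \<noteq> 0"
    using assms by (auto simp: invertible_def)
  then show ?thesis
    unfolding degree_one_map_def by (intro exI[of _ A] exI[of _ 0]) auto
qed

section \<open>The equivalence\<close>

theorem theorem3p9:
  fixes F :: "('n::finite) polymap"
  shows "let
      L = map_of_polymap (linear_part F);
      S1 = (\<forall>\<alpha> :: nat \<Rightarrow> complex^'n.
              invertible (\<Sum>i=1..CARD('n). eval_matrix (jacobian_matrix F) (\<alpha> i)));
      S2 = (\<exists>H :: 'n polymap.
              map_of_polymap F = L \<circ> map_of_polymap (coordinates + H) \<and>
              linear_part H = 0 \<and> bij L \<and> additive_nilpotent (jacobian_matrix H));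
      S3 = (\<exists>H :: 'n polymap.
              map_of_polymap F = map_of_polymap (coordinates + H) \<circ> L \<and>
              linear_part H = 0 \<and> bij L \<and> additive_nilpotent (jacobian_matrix H));
      S4 = (\<exists>(L1 :: complex^'n \<Rightarrow> complex^'n) (L2 :: complex^'n \<Rightarrow> complex^'n) (H :: 'n polymap).
              map_of_polymap F = L1 \<circ> map_of_polymap (coordinates + H) \<circ> L2 \<and>
              degree_one_map L1 \<and> bij L1 \<and> degree_one_map L2 \<and> bij L2 \<and>
              additive_nilpotent (jacobian_matrix H))
    in (S1 \<longleftrightarrow> S2) \<and> (S2 \<longleftrightarrow> S3) \<and> (S3 \<longleftrightarrow> S4)"
proof -
  define L where "L = map_of_polymap (linear_part F)"
  define S1 where "S1 \<longleftrightarrow> (\<forall>\<alpha> :: nat \<Rightarrow> complex^'n. invertible (\<Sum>i=1..CARD('n). jac F (\<alpha> i)))"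
  define S2 where "S2 \<longleftrightarrow> (\<exists>H :: 'n polymap.
              map_of_polymap F = L \<circ> map_of_polymap (coordinates + H) \<and>
              linear_part H = 0 \<and> bij L \<and> additive_nilpotent (jacobian_matrix H))"
  define S3 where "S3 \<longleftrightarrow> (\<exists>H :: 'n polymap.
              map_of_polymap F = map_of_polymap (coordinates + H) \<circ> L \<and>
              linear_part H = 0 \<and> bij L \<and> additive_nilpotent (jacobian_matrix H))"
  define S4 where "S4 \<longleftrightarrow> (\<exists>(L1 :: complex^'n \<Rightarrow> complex^'n) (L2 :: complex^'n \<Rightarrow> complex^'n) (H :: 'n polymap).
              map_of_polymap F = L1 \<circ> map_of_polymap (coordinates + H) \<circ> L2 \<and>
              degree_one_map L1 \<and> bij L1 \<and> degree_one_map L2 \<and> bij L2 \<and>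
              additive_nilpotent (jacobian_matrix H))"
  have L: "L = (*v) (jac F 0)"
    by (simp add: L_def fun_eq_iff map_of_linear_part)
  have bij_L: "bij L \<longleftrightarrow> invertible (jac F 0)"
    by (simp add: L invertible_eq_bij)
  have "invertible (mat 1 :: complex^'n^'n)"
    by (simp add: invertible_det_nz)
  moreover have "(*v) (mat 1) = (id :: complex^'n \<Rightarrow> complex^'n)"
    by (simp add: fun_eq_iff)
  ultimately have id: "degree_one_map (id :: complex^'n \<Rightarrow> complex^'n)"
    using degree_one_map_if_invertible by metis
  have S1_imp: "S2 \<and> S3" if S1
  proof -
    have inv: "invertible (\<Sum>i=1..CARD('n). jac F (\<alpha> i))" for \<alpha> :: "nat \<Rightarrow> complex^'n"
      using that by (auto simp: S1_def)
    have "(\<Sum>i=1..CARD('n). jac F 0) = mat (of_nat CARD('n)) ** jac F 0"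
      by (simp add: vec_eq_iff del: sum_constant) simp
    then have "det (jac F 0) \<noteq> 0"
      using inv[of "\<lambda>_. 0"] by (simp add: invertible_det_nz det_mul)
    then have invJ: "invertible (jac F 0)"
      by (simp add: invertible_det_nz)
    then obtain J where J: "J ** jac F 0 = mat 1" "jac F 0 ** J = mat 1"
      by (auto simp: invertible_def)
    obtain H where "map_of_polymap (coordinates + H) = (\<lambda>x. J *v map_of_polymap F x)"
      and H: "linear_part H = 0" "additive_nilpotent (jacobian_matrix H)"
      using normalised_polymap[OF inv, of J "mat 1"] J by auto
    then have "map_of_polymap F = L \<circ> map_of_polymap (coordinates + H)"
      by (simp add: L fun_eq_iff matrix_vector_mul_assoc J)
    with H invJ have S2
      unfolding S2_def bij_L by blast
    obtain H' where "map_of_polymap (coordinates + H') = (\<lambda>x. map_of_polymap F (J *v x))"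
      and H': "linear_part H' = 0" "additive_nilpotent (jacobian_matrix H')"
      using normalised_polymap[OF inv, of "mat 1" J] J by auto
    then have "map_of_polymap F = map_of_polymap (coordinates + H') \<circ> L"
      by (simp add: L fun_eq_iff matrix_vector_mul_assoc J)
    with H' invJ have S3
      unfolding S3_def bij_L by blast
    with \<open>S2\<close> show ?thesis ..
  qed
  have deg_L: "degree_one_map L" if "bij L"
    using that degree_one_map_if_invertible bij_L L by metis
  have S2_imp: S4 if S2
    using that id deg_L unfolding S2_def S4_def by (metis bij_id comp_id)
  have S3_imp: S4 if S3
    using that id deg_L unfolding S3_def S4_def by (metis bij_id id_comp)
  have S4_imp: S1 if hyp: S4
  proof -
    obtain L1 L2 and H :: "'n polymap" where F: "map_of_polymap F = L1 \<circ> map_of_polymap (coordinates + H) \<circ> L2"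
      and "degree_one_map L1" "bij L1" "degree_one_map L2" "bij L2"
      and H: "additive_nilpotent (jacobian_matrix H)"
      using hyp unfolding S4_def by blast
    then obtain A a B b where L1: "L1 = (\<lambda>x. A *v x + a)" and L2: "L2 = (\<lambda>x. B *v x + b)"
      by (auto simp: degree_one_map_def)
    have inv: "invertible A" "invertible B"
      using \<open>bij L1\<close> \<open>bij L2\<close> by (simp_all add: L1 L2 bij_affine_iff_invertible)
    have "jac F x = A ** jac (coordinates + H) (B *v x + b) ** B" for x
      by (rule jac_affine_conjugate) (simp add: F L1 L2 fun_eq_iff)
    then show S1
      unfolding S1_def using inv
      by (simp only: sum_matrix_conjugate)
         (intro allI invertible_mult invertible_if_additive_nilpotent[OF H])
  qed
  have "(S1 \<longleftrightarrow> S2) \<and> (S2 \<longleftrightarrow> S3) \<and> (S3 \<longleftrightarrow> S4)"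
    using S1_imp S2_imp S3_imp S4_imp by blast
  then show ?thesis
    by (simp add: Let_def S1_def S2_def S3_def S4_def L_def)
qed

end
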